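(* Let $\Sigma$ be an oriented surface and $\nabla$ a torsion-free connection on $T\Sigma$ which is Lagrangian and timelike or spacelike. Then $\nabla$ is minimal if and only if $$R^{ij}\left(2\nabla_iR_{jk}-\nabla_kR_{ij}\right)=0,$$ where $R_{ij}$ denotes the (symmetric, non-degenerate) Ricci tensor of $\nabla$ and $R^{ij}$ its inverse, $R^{ij}R_{jk}=\delta^i_k$.
   Context: All manifolds and maps are smooth; surfaces have no boundary; repeated indices are summed. For a torsion-free connection $\nabla$ on $T\Sigma$ the Ricci tensor is $\mathrm{Ric}(\nabla)(X,Y)=\mathrm{tr}\,(Z\mapsto \nabla_Z\nabla_XY-\nabla_X\nabla_ZY-\nabla_{[Z,X]}Y)$, with symmetric part $\mathrm{Ric}^+(\nabla)$ and anti-symmetric part $\mathrm{Ric}^-(\nabla)$; put $\mathrm{Schout}(\nabla)=\mathrm{Ric}^+(\nabla)-\frac13\mathrm{Ric}^-(\nabla)$. Define a split-signature metric $h_\nabla$ on the total space of $T^*\Sigma$ as follows: in local coordinates $x^i$ on $\Sigma$ with fibre coordinates $\xi_i$ (covector $\xi_i dx^i$), with $\nabla_{\partial_i}\partial_j=\Gamma^k_{ij}\partial_k$ and $\mathrm{Schout}(\nabla)=S_{ij}dx^i\otimes dx^j$, let $\psi_i=d\xi_i-\xi_k\Gamma^k_{ij}dx^j-\xi_i\xi_jdx^j-S_{ji}dx^j$; then $h_\nabla$ is the symmetric part of $\psi_i\otimes dx^i$ (coordinate independent). With $o:\Sigma\to T^*\Sigma$ the zero section, $o^*h_\nabla=-\mathrm{Ric}^+(\nabla)$.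 The connection $\nabla$ is called Lagrangian if $\mathrm{Ric}^-(\nabla)=0$, timelike (spacelike) if $\mathrm{Ric}^+(\nabla)$ is positive (negative) definite, and minimal if the trace, with respect to the induced metric $g=\pm\mathrm{Ric}(\nabla)$ ($+$ timelike, $-$ spacelike), of the second fundamental form of $o:\Sigma\to(T^*\Sigma,h_\nabla)$ vanishes identically. *)

theory Defs
  imports "HOL-Analysis.Analysis"
begin

section \<open>Smooth maps between Euclidean spaces\<close>

text \<open>Differentiability of all orders on an open set, phrased by iterated directional
  derivatives.\<close>

fun higher_differentiable_on ::
    "nat \<Rightarrow> 'n::euclidean_space set \<Rightarrow> ('n \<Rightarrow> 'm::real_normed_vector) \<Rightarrow> bool" where
  "higher_differentiable_on 0 S f \<longleftrightarrow> continuous_on S f"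
| "higher_differentiable_on (Suc k) S f \<longleftrightarrow>
     (\<forall>x\<in>S. f differentiable at x) \<and>
     (\<forall>v. higher_differentiable_on k S (\<lambda>x. frechet_derivative f (at x) v))"

definition smooth_on :: "'n::euclidean_space set \<Rightarrow> ('n \<Rightarrow> 'm::real_normed_vector) \<Rightarrow> bool" where
  "smooth_on S f \<longleftrightarrow> (\<forall>k. higher_differentiable_on k S f)"


section \<open>Oriented surfaces\<close>

text \<open>A chart is a pair of its domain and its coordinate map; the values of the map outside
  the domain are irrelevant. The surface is the whole type \<open>'a\<close>.\<close>

type_synonym 'a chart = "'a set \<times> ('a \<Rightarrow> real^2)"

definition chart_inv :: "'a chart \<Rightarrow> real^2 \<Rightarrow> 'a" where
  "chart_inv c = inv_into (fst c) (snd c)"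

abbreviation chart_image :: "'a chart \<Rightarrow> (real^2) set" where
  "chart_image c \<equiv> snd c ` fst c"

definition transition :: "'a chart \<Rightarrow> 'a chart \<Rightarrow> real^2 \<Rightarrow> real^2" where
  "transition c d = snd d \<circ> chart_inv c"

definition is_chart :: "'a::topological_space chart \<Rightarrow> bool" where
  "is_chart c \<longleftrightarrow> open (fst c) \<and> open (chart_image c) \<and>
     homeomorphism (fst c) (chart_image c) (snd c) (chart_inv c)"

text \<open>A smooth atlas with orientation preserving transition maps. The Hausdorff and second
  countability conditions are expressed by the sort of \<open>'a\<close>.\<close>

definition oriented_surface ::
    "'a::{t2_space,second_countable_topology} chart set \<Rightarrow> bool" where
  "oriented_surface A \<longleftrightarrow>
     (\<forall>c\<in>A. is_chart c) \<and>
     (\<Union>c\<in>A. fst c) = UNIV \<and>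
     (\<forall>c\<in>A. \<forall>d\<in>A.
        smooth_on (snd c ` (fst c \<inter> fst d)) (transition c d) \<and>
        (\<forall>x \<in> snd c ` (fst c \<inter> fst d).
           det (matrix (frechet_derivative (transition c d) (at x))) > 0))"


section \<open>Tangent vectors, functions and vector fields\<close>

text \<open>A tangent vector at \<open>p\<close> is the family of its component vectors in all charts of the atlas
  around \<open>p\<close>, related by the Jacobians of the transition maps; the entries for other charts are
  set to zero so that equality is meaningful.\<close>

type_synonym 'a tangent = "'a chart \<Rightarrow> real^2"

definition tangent_space :: "'a chart set \<Rightarrow> 'a \<Rightarrow> 'a tangent set" where
  "tangent_space A p = {v.
     (\<forall>c. c \<notin> A \<or> p \<notin> fst c \<longrightarrow> v c = 0) \<and>
     (\<forall>c\<in>A. \<forall>d\<in>A. p \<in> fst c \<inter> fst d \<longrightarrow>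
        v d = frechet_derivative (transition c d) (at (snd c p)) (v c))}"

definition smooth_functions :: "'a chart set \<Rightarrow> 'a set \<Rightarrow> ('a \<Rightarrow> real) set" where
  "smooth_functions A W = {f. \<forall>c\<in>A. smooth_on (snd c ` (fst c \<inter> W)) (f \<circ> chart_inv c)}"

type_synonym 'a field = "'a \<Rightarrow> 'a tangent"

definition field_comp :: "'a chart \<Rightarrow> 'a field \<Rightarrow> real^2 \<Rightarrow> real^2" where
  "field_comp c X x = X (chart_inv c x) c"

text \<open>Smooth vector fields over the open set \<open>W\<close>; values outside \<open>W\<close> are arbitrary.\<close>

definition vector_fields :: "'a chart set \<Rightarrow> 'a set \<Rightarrow> 'a field set" where
  "vector_fields A W = {X.
     (\<forall>p\<in>W. X p \<in> tangent_space A p) \<and>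
     (\<forall>c\<in>A. smooth_on (snd c ` (fst c \<inter> W)) (field_comp c X))}"

text \<open>The derivative \<open>X f\<close> at \<open>p\<close>, computed in a chart \<open>c\<close> around \<open>p\<close>.\<close>

definition field_deriv :: "'a chart \<Rightarrow> 'a field \<Rightarrow> ('a \<Rightarrow> real) \<Rightarrow> 'a \<Rightarrow> real" where
  "field_deriv c X f p = frechet_derivative (f \<circ> chart_inv c) (at (snd c p)) (X p c)"

definition bracket :: "'a chart set \<Rightarrow> 'a field \<Rightarrow> 'a field \<Rightarrow> 'a field" where
  "bracket A X Y p c =
     (if c \<in> A \<and> p \<in> fst c
      then frechet_derivative (field_comp c Y) (at (snd c p)) (X p c)
         - frechet_derivative (field_comp c X) (at (snd c p)) (Y p c)
      else 0)"

text \<open>The coordinate vector field \<open>\<partial>\<^sub>i\<close> of the chart \<open>c\<close>, a vector field over \<open>fst c\<close>.\<close>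

definition coord_field :: "'a chart set \<Rightarrow> 'a chart \<Rightarrow> 2 \<Rightarrow> 'a field" where
  "coord_field A c i p d =
     (if d \<in> A \<and> p \<in> fst c \<inter> fst d
      then frechet_derivative (transition c d) (at (snd c p)) (axis i 1)
      else 0)"


section \<open>Connections and their Ricci tensor\<close>

text \<open>A connection on the tangent bundle as a covariant derivative acting on the smooth vector
  fields over every open set. As vector fields are total functions with arbitrary values outside
  \<open>W\<close>, the second conjunct states independence of these values; since \<open>W\<close> is
  arbitrary it also contains the compatibility with restriction to smaller open sets.\<close>

definition connection ::
    "'a::topological_space chart set \<Rightarrow> ('a field \<Rightarrow> 'a field \<Rightarrow> 'a field) \<Rightarrow> bool" where
  "connection A nabla \<longleftrightarrow>
     (\<forall>W. open W \<longrightarrow> (\<forall>X \<in> vector_fields A W. \<forall>Y \<in> vector_fields A W.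
        nabla X Y \<in> vector_fields A W \<and>
        (\<forall>X' \<in> vector_fields A W. \<forall>Y' \<in> vector_fields A W.
           (\<forall>p\<in>W. X' p = X p \<and> Y' p = Y p) \<longrightarrow> (\<forall>p\<in>W. nabla X' Y' p = nabla X Y p)) \<and>
        (\<forall>X' \<in> vector_fields A W. \<forall>p\<in>W. \<forall>c.
           nabla (\<lambda>q d. X q d + X' q d) Y p c = nabla X Y p c + nabla X' Y p c) \<and>
        (\<forall>Y' \<in> vector_fields A W. \<forall>p\<in>W. \<forall>c.
           nabla X (\<lambda>q d. Y q d + Y' q d) p c = nabla X Y p c + nabla X Y' p c) \<and>
        (\<forall>f \<in> smooth_functions A W. \<forall>p\<in>W. \<forall>c.
           nabla (\<lambda>q d. f q *\<^sub>R X q d) Y p c = f p *\<^sub>R nabla X Y p c) \<and>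
        (\<forall>f \<in> smooth_functions A W. \<forall>c\<in>A. \<forall>p \<in> W \<inter> fst c.
           nabla X (\<lambda>q d. f q *\<^sub>R Y q d) p c
             = field_deriv c X f p *\<^sub>R Y p c + f p *\<^sub>R nabla X Y p c)))"

definition torsion_free ::
    "'a::topological_space chart set \<Rightarrow> ('a field \<Rightarrow> 'a field \<Rightarrow> 'a field) \<Rightarrow> bool" where
  "torsion_free A nabla \<longleftrightarrow>
     (\<forall>W. open W \<longrightarrow> (\<forall>X \<in> vector_fields A W. \<forall>Y \<in> vector_fields A W. \<forall>p\<in>W. \<forall>c.
        nabla X Y p c - nabla Y X p c = bracket A X Y p c))"

definition curvature ::
    "'a chart set \<Rightarrow> ('a field \<Rightarrow> 'a field \<Rightarrow> 'a field) \<Rightarrow> 'a field \<Rightarrow> 'a field \<Rightarrow> 'a field \<Rightarrow> 'a field"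
  where
  "curvature A nabla Z X Y p c =
     nabla Z (nabla X Y) p c - nabla X (nabla Z Y) p c - nabla (bracket A Z X) Y p c"

text \<open>\<open>Ric(X,Y)\<close> at \<open>p\<close>: the trace of \<open>Z \<mapsto> curvature A nabla Z X Y\<close> in the basis
  \<open>\<partial>\<^sub>1, \<partial>\<^sub>2\<close> of the tangent space at \<open>p\<close>.\<close>

definition ricci ::
    "'a chart set \<Rightarrow> ('a field \<Rightarrow> 'a field \<Rightarrow> 'a field) \<Rightarrow> 'a chart \<Rightarrow> 'a field \<Rightarrow> 'a field \<Rightarrow> 'a \<Rightarrow> real"
  where
  "ricci A nabla c X Y p = (\<Sum>k\<in>UNIV. curvature A nabla (coord_field A c k) X Y p c $ k)"

definition christoffel ::
    "'a chart set \<Rightarrow> ('a field \<Rightarrow> 'a field \<Rightarrow> 'a field) \<Rightarrow> 'a chart \<Rightarrow> 2 \<Rightarrow> 2 \<Rightarrow> 2 \<Rightarrow> real^2 \<Rightarrow> real"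
  where \<comment> \<open>\<open>\<Gamma>\<^sup>k\<^sub>i\<^sub>j\<close>, with \<open>k\<close> the first index\<close>
  "christoffel A nabla c k i j x =
     nabla (coord_field A c i) (coord_field A c j) (chart_inv c x) c $ k"

definition ric :: "'a chart set \<Rightarrow> ('a field \<Rightarrow> 'a field \<Rightarrow> 'a field) \<Rightarrow> 'a chart \<Rightarrow> real^2 \<Rightarrow> real^2^2"
  where
  "ric A nabla c x =
     (\<chi> i j. ricci A nabla c (coord_field A c i) (coord_field A c j) (chart_inv c x))"

definition ric_sym :: "'a chart set \<Rightarrow> ('a field \<Rightarrow> 'a field \<Rightarrow> 'a field) \<Rightarrow> 'a chart \<Rightarrow> real^2 \<Rightarrow> real^2^2"
  where
  "ric_sym A nabla c x = (1/2) *\<^sub>R (ric A nabla c x + transpose (ric A nabla c x))"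

definition ric_anti :: "'a chart set \<Rightarrow> ('a field \<Rightarrow> 'a field \<Rightarrow> 'a field) \<Rightarrow> 'a chart \<Rightarrow> real^2 \<Rightarrow> real^2^2"
  where
  "ric_anti A nabla c x = (1/2) *\<^sub>R (ric A nabla c x - transpose (ric A nabla c x))"

definition schout :: "'a chart set \<Rightarrow> ('a field \<Rightarrow> 'a field \<Rightarrow> 'a field) \<Rightarrow> 'a chart \<Rightarrow> real^2 \<Rightarrow> real^2^2"
  where
  "schout A nabla c x = ric_sym A nabla c x - (1/3) *\<^sub>R ric_anti A nabla c x"

text \<open>\<open>\<nabla>\<^sub>i R\<^sub>j\<^sub>k\<close>\<close>

definition cov_deriv_ric ::
    "'a chart set \<Rightarrow> ('a field \<Rightarrow> 'a field \<Rightarrow> 'a field) \<Rightarrow> 'a chart \<Rightarrow> 2 \<Rightarrow> 2 \<Rightarrow> 2 \<Rightarrow> real^2 \<Rightarrow> real"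
  where
  "cov_deriv_ric A nabla c i j k x =
     frechet_derivative (\<lambda>y. ric A nabla c y $ j $ k) (at x) (axis i 1)
     - (\<Sum>m\<in>UNIV. christoffel A nabla c m i j x * ric A nabla c x $ m $ k)
     - (\<Sum>m\<in>UNIV. christoffel A nabla c m i k x * ric A nabla c x $ j $ m)"

definition lagrangian :: "'a chart set \<Rightarrow> ('a field \<Rightarrow> 'a field \<Rightarrow> 'a field) \<Rightarrow> bool" where
  "lagrangian A nabla \<longleftrightarrow> (\<forall>c\<in>A. \<forall>x\<in>chart_image c. ric_anti A nabla c x = 0)"

definition timelike :: "'a chart set \<Rightarrow> ('a field \<Rightarrow> 'a field \<Rightarrow> 'a field) \<Rightarrow> bool" where
  "timelike A nabla \<longleftrightarrow>
     (\<forall>c\<in>A. \<forall>x\<in>chart_image c. \<forall>u. u \<noteq> 0 \<longrightarrow> u \<bullet> (ric_sym A nabla c x *v u) > 0)"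

definition spacelike :: "'a chart set \<Rightarrow> ('a field \<Rightarrow> 'a field \<Rightarrow> 'a field) \<Rightarrow> bool" where
  "spacelike A nabla \<longleftrightarrow>
     (\<forall>c\<in>A. \<forall>x\<in>chart_image c. \<forall>u. u \<noteq> 0 \<longrightarrow> u \<bullet> (ric_sym A nabla c x *v u) < 0)"


section \<open>Pseudo-Riemannian metrics and the second fundamental form in coordinates\<close>

text \<open>Here \<open>h q u v\<close> is a pseudo-Riemannian metric on an open subset of a Euclidean space. The
  Levi-Civita connection at \<open>p\<close> is given by the bilinear map \<open>G\<close> (its Christoffel symbols) that is
  symmetric (torsion-free) and compatible with the metric:
  \<open>\<partial>\<^sub>u h(v,w) = h(\<nabla>\<^sub>u v, w) + h(v, \<nabla>\<^sub>u w)\<close> for constant fields.\<close>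

definition levi_civita ::
    "('n::euclidean_space \<Rightarrow> 'n \<Rightarrow> 'n \<Rightarrow> real) \<Rightarrow> 'n \<Rightarrow> 'n \<Rightarrow> 'n \<Rightarrow> 'n" where
  "levi_civita h p = (THE G. bilinear G \<and> (\<forall>u v. G u v = G v u) \<and>
     (\<forall>u v w. frechet_derivative (\<lambda>q. h q v w) (at p) u = h p (G u v) w + h p v (G u w)))"

definition normal_part ::
    "('n::euclidean_space \<Rightarrow> 'n \<Rightarrow> 'n \<Rightarrow> real) \<Rightarrow> ('m::euclidean_space \<Rightarrow> 'n) \<Rightarrow> 'm \<Rightarrow> 'n \<Rightarrow> 'n" where
  "normal_part h f x V = (THE N.
     (\<exists>w. V = frechet_derivative f (at x) w + N) \<and>
     (\<forall>w. h (f x) N (frechet_derivative f (at x) w) = 0))"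

text \<open>The normal part of the ambient derivative of \<open>f\<^sub>* v\<close> in direction \<open>f\<^sub>* u\<close>, where
  \<open>v\<close> is extended to a constant vector field on the parameter domain.\<close>

definition second_fundamental_form ::
    "('n::euclidean_space \<Rightarrow> 'n \<Rightarrow> 'n \<Rightarrow> real) \<Rightarrow> ('m::euclidean_space \<Rightarrow> 'n) \<Rightarrow> 'm \<Rightarrow> 'm \<Rightarrow> 'm \<Rightarrow> 'n"
  where
  "second_fundamental_form h f x u v = normal_part h f x
     (frechet_derivative (\<lambda>y. frechet_derivative f (at y) v) (at x) u
      + levi_civita h (f x) (frechet_derivative f (at x) u) (frechet_derivative f (at x) v))"


section \<open>The metric on the cotangent bundle and minimal connections\<close>

text \<open>Points of the cotangent bundle are pairs of a point and a linear form on its tangent space.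
  A chart \<open>c\<close> induces the chart with coordinates \<open>(x\<^sup>i, \<xi>\<^sub>i)\<close>, where
  \<open>\<xi>\<^sub>i = \<alpha>(\<partial>\<^sub>i)\<close>.\<close>

type_synonym 'a cotangent_point = "'a \<times> ('a tangent \<Rightarrow> real)"

definition cotangent_chart ::
    "'a chart set \<Rightarrow> 'a chart \<Rightarrow> 'a cotangent_point \<Rightarrow> (real^2) \<times> (real^2)" where
  "cotangent_chart A c = (\<lambda>(p, \<alpha>). (snd c p, \<chi> i. \<alpha> (coord_field A c i p)))"

definition zero_section :: "'a \<Rightarrow> 'a cotangent_point" where
  "zero_section p = (p, \<lambda>_. 0)"

text \<open>The 1-forms \<open>\<psi>\<^sub>i\<close> at \<open>(x, \<xi>)\<close>, evaluated on the vector \<open>(v, \<zeta>)\<close>, i.e.\ with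
  \<open>dx\<^sup>j = v\<^sup>j\<close> and \<open>d\<xi>\<^sub>i = \<zeta>\<^sub>i\<close>.\<close>

definition psi ::
    "'a chart set \<Rightarrow> ('a field \<Rightarrow> 'a field \<Rightarrow> 'a field) \<Rightarrow> 'a chart \<Rightarrow> 2 \<Rightarrow>
     (real^2) \<times> (real^2) \<Rightarrow> (real^2) \<times> (real^2) \<Rightarrow> real" where
  "psi A nabla c i = (\<lambda>(x, \<xi>) (v, \<zeta>).
     \<zeta> $ i
     - (\<Sum>j\<in>UNIV. \<Sum>k\<in>UNIV. \<xi> $ k * christoffel A nabla c k i j x * v $ j)
     - (\<Sum>j\<in>UNIV. \<xi> $ i * \<xi> $ j * v $ j)
     - (\<Sum>j\<in>UNIV. schout A nabla c x $ j $ i * v $ j))"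

text \<open>The symmetric part of \<open>\<psi>\<^sub>i \<otimes> dx\<^sup>i\<close>.\<close>

definition cotangent_metric ::
    "'a chart set \<Rightarrow> ('a field \<Rightarrow> 'a field \<Rightarrow> 'a field) \<Rightarrow> 'a chart \<Rightarrow>
     (real^2) \<times> (real^2) \<Rightarrow> (real^2) \<times> (real^2) \<Rightarrow> (real^2) \<times> (real^2) \<Rightarrow> real" where
  "cotangent_metric A nabla c q a b =
     (1/2) * (\<Sum>i\<in>UNIV. psi A nabla c i q a * fst b $ i + psi A nabla c i q b * fst a $ i)"

definition induced_metric ::
    "'a chart set \<Rightarrow> ('a field \<Rightarrow> 'a field \<Rightarrow> 'a field) \<Rightarrow> 'a chart \<Rightarrow> real^2 \<Rightarrow> real^2^2" where
  "induced_metric A nabla c x =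
     (if timelike A nabla then ric A nabla c x else - ric A nabla c x)"

definition minimal_connection ::
    "'a chart set \<Rightarrow> ('a field \<Rightarrow> 'a field \<Rightarrow> 'a field) \<Rightarrow> bool" where
  "minimal_connection A nabla \<longleftrightarrow> (\<forall>c\<in>A. \<forall>x\<in>chart_image c.
     (\<Sum>i\<in>UNIV. \<Sum>j\<in>UNIV. matrix_inv (induced_metric A nabla c x) $ i $ j *\<^sub>R
        second_fundamental_form (cotangent_metric A nabla c)
          (cotangent_chart A c \<circ> zero_section \<circ> chart_inv c) x (axis i 1) (axis j 1)) = 0)"

end

theory Submission
  imports Defs
begin

text \<open>In the chart \<open>(x, \<xi>)\<close> the zero section is \<open>x \<mapsto> (x, 0)\<close>, so its
  second fundamental form at \<open>(\<partial>\<^sub>i, \<partial>\<^sub>j)\<close> is the normal part of the Levi-Civita term.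
  A vector \<open>(n, \<nu>)\<close> is normal to the zero section iff \<open>\<nu> = 2 R n\<close>, so the normal part of
  \<open>(a, \<alpha>)\<close> is \<open>(R\<^sup>-\<^sup>1 \<alpha> / 2, \<alpha>)\<close> and depends only, injectively and linearly, on \<open>\<alpha>\<close>.
  The Koszul formula for \<open>h\<close> along \<open>\<xi> = 0\<close>, tested against the fibre directions, gives
  \<open>a\<^sup>k = \<Gamma>\<^sup>k\<^sub>i\<^sub>j\<close>, and then, tested against \<open>\<partial>\<^sub>k\<close>, it gives
  \<open>\<alpha>\<^sub>k = - (\<nabla>\<^sub>i R\<^sub>j\<^sub>k + \<nabla>\<^sub>j R\<^sub>i\<^sub>k - \<nabla>\<^sub>k R\<^sub>i\<^sub>j)\<close>; the trace of this with
  \<open>R\<^sup>i\<^sup>j\<close> is the negative of the stated expression.\<close>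

section \<open>Calculus of smooth maps\<close>

text \<open>Since \<open>S\<close> is open, functions agreeing on \<open>S\<close> have the same
  derivatives there. This allows a derivative to be replaced by a formula that is valid only on
  \<open>S\<close>.\<close>

lemma higher_differentiable_on_cong:
  assumes "open S" "\<And>x. x \<in> S \<Longrightarrow> f x = g x" "higher_differentiable_on k S f"
  shows "higher_differentiable_on k S g"
  using assms(2,3)
proof (induction k arbitrary: f g)
  case 0
  then show ?case by (simp cong: continuous_on_cong)
next
  case (Suc k)
  have g: "g differentiable at x"
    and eq: "frechet_derivative f (at x) = frechet_derivative g (at x)" if "x \<in> S" for x
  proof -
    have f: "f differentiable at x" using Suc.prems that by simp
    have "(f has_derivative frechet_derivative f (at x)) (at x)"
      using f frechet_derivative_works by blast
    then have *: "(g has_derivative frechet_derivative f (at x)) (at x)"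
      by (rule has_derivative_transform_within_open[OF _ assms(1) that]) (use Suc.prems in auto)
    then show "g differentiable at x" unfolding differentiable_def by blast
    show "frechet_derivative f (at x) = frechet_derivative g (at x)"
      using * by (rule frechet_derivative_at)
  qed
  have "higher_differentiable_on k S (\<lambda>x. frechet_derivative g (at x) v)" for v
    by (rule Suc.IH[of "\<lambda>x. frechet_derivative f (at x) v"]) (use Suc.prems eq in auto)
  with g show ?case by simp
qed

text \<open>The base case is that differentiability implies continuity. The product and chain rules
  leave some factors undifferentiated, and these are needed at the lower order.\<close>

lemma higher_differentiable_on_SucD:
  "higher_differentiable_on (Suc k) S f \<Longrightarrow> higher_differentiable_on k S f"
proof (induction k arbitrary: f)
  case 0
  then show ?case
    by (auto intro!: continuous_at_imp_continuous_on differentiable_imp_continuous_within)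
next
  case (Suc k)
  then show ?case
    unfolding higher_differentiable_on.simps(2)[of "Suc k"] higher_differentiable_on.simps(2)[of k]
    by simp
qed

lemma higher_differentiable_on_const: "higher_differentiable_on k S (\<lambda>x. c)"
  by (induction k arbitrary: c) (auto simp: frechet_derivative_const)

lemma frechet_derivativeI: "(f has_derivative f') (at x) \<Longrightarrow> frechet_derivative f (at x) = f'"
  by (metis frechet_derivative_at)

lemma higher_differentiable_on_add:
  assumes "open S" "higher_differentiable_on k S f" "higher_differentiable_on k S g"
  shows "higher_differentiable_on k S (\<lambda>x. f x + g x)"
  using assms(2,3)
proof (induction k arbitrary: f g)
  case 0
  then show ?case by (auto intro: continuous_on_add)
next
  case (Suc k)
  have "frechet_derivative (\<lambda>x. f x + g x) (at x)
      = (\<lambda>v. frechet_derivative f (at x) v + frechet_derivative g (at x) v)" if "x \<in> S" for x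
    by (rule frechet_derivativeI) (use Suc.prems that in
        \<open>auto intro!: derivative_eq_intros simp: frechet_derivative_works[symmetric]\<close>)
  moreover from Suc.prems have "higher_differentiable_on k S
      (\<lambda>x. frechet_derivative f (at x) v + frechet_derivative g (at x) v)" for v
    by (intro Suc.IH) auto
  ultimately have "higher_differentiable_on k S
      (\<lambda>x. frechet_derivative (\<lambda>x. f x + g x) (at x) v)" for v
    using higher_differentiable_on_cong[OF assms(1), of
        "\<lambda>x. frechet_derivative f (at x) v + frechet_derivative g (at x) v"] by simp
  then show ?case using Suc.prems by auto
qed

lemma higher_differentiable_on_scaleR:
  fixes f :: "'n::euclidean_space \<Rightarrow> real"
  assumes "open S" "higher_differentiable_on k S f" "higher_differentiable_on k S g"
  shows "higher_differentiable_on k S (\<lambda>x. f x *\<^sub>R g x)"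
  using assms(2,3)
proof (induction k arbitrary: f g)
  case 0
  then show ?case by (auto intro: continuous_on_scaleR)
next
  case (Suc k)
  have d: "((\<lambda>x. f x *\<^sub>R g x) has_derivative
      (\<lambda>v. f x *\<^sub>R frechet_derivative g (at x) v + frechet_derivative f (at x) v *\<^sub>R g x)) (at x)"
    if "x \<in> S" for x
    by (rule has_derivative_scaleR) (use Suc.prems that in
        \<open>auto simp: frechet_derivative_works[symmetric]\<close>)
  have "higher_differentiable_on k S
      (\<lambda>x. f x *\<^sub>R frechet_derivative g (at x) v + frechet_derivative f (at x) v *\<^sub>R g x)" for v
    using Suc.prems higher_differentiable_on_SucD[OF Suc.prems(1)]
      higher_differentiable_on_SucD[OF Suc.prems(2)]
    by (intro higher_differentiable_on_add assms(1) Suc.IH) simp_all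
  then have "higher_differentiable_on k S
      (\<lambda>x. frechet_derivative (\<lambda>x. f x *\<^sub>R g x) (at x) v)" for v
    by (rule higher_differentiable_on_cong[OF assms(1), rotated])
       (simp add: frechet_derivativeI[OF d])
  then show ?case using d by (auto simp: differentiable_def)
qed

lemma higher_differentiable_on_sum:
  assumes "open S" "finite I" "\<And>i. i \<in> I \<Longrightarrow> higher_differentiable_on k S (f i)"
  shows "higher_differentiable_on k S (\<lambda>x. \<Sum>i\<in>I. f i x)"
  using assms(2,3)
  by (induction I rule: finite_induct)
     (auto intro: higher_differentiable_on_const higher_differentiable_on_add[OF assms(1)])

lemma higher_differentiable_on_linear:
  assumes L: "bounded_linear L" and "open S" "higher_differentiable_on k S f"
  shows "higher_differentiable_on k S (\<lambda>x. L (f x))"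
  using assms(3)
proof (induction k arbitrary: f)
  case 0
  then show ?case by (simp add: bounded_linear.continuous_on[OF L])
next
  case (Suc k)
  have d: "((\<lambda>x. L (f x)) has_derivative (\<lambda>v. L (frechet_derivative f (at x) v))) (at x)"
    if "x \<in> S" for x
    by (rule bounded_linear.has_derivative[OF L]) (use Suc.prems that in
        \<open>auto simp: frechet_derivative_works[symmetric]\<close>)
  have "higher_differentiable_on k S (\<lambda>x. L (frechet_derivative f (at x) v))" for v
    by (rule Suc.IH) (use Suc.prems in auto)
  then have "higher_differentiable_on k S (\<lambda>x. frechet_derivative (\<lambda>x. L (f x)) (at x) v)" for v
    by (rule higher_differentiable_on_cong[OF assms(2), rotated])
       (simp add: frechet_derivativeI[OF d])
  then show ?case using d by (auto simp: differentiable_def)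
qed

lemma higher_differentiable_on_compose:
  fixes f :: "'m::euclidean_space \<Rightarrow> 'l::real_normed_vector" and g :: "'n::euclidean_space \<Rightarrow> 'm"
  assumes "open S" "g ` S \<subseteq> T" "higher_differentiable_on k T f" "higher_differentiable_on k S g"
  shows "higher_differentiable_on k S (\<lambda>x. f (g x))"
  using assms(3,4)
proof (induction k arbitrary: f)
  case 0
  then show ?case using assms(2) by (auto intro: continuous_on_compose2)
next
  case (Suc k)
  \<comment> \<open>Chain rule with the derivative of \<open>g\<close> expanded in
    \<open>Basis\<close>: the derivatives of \<open>f\<close> are then taken in fixed directions
    \<open>b\<close>, so the induction hypothesis applies to their composition with
    \<open>g\<close>.\<close>
  let ?D = "\<lambda>v x. \<Sum>b\<in>Basis. (frechet_derivative g (at x) v \<bullet> b) *\<^sub>R frechet_derivative f (at (g x)) b"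
  have d: "((\<lambda>x. f (g x)) has_derivative (\<lambda>v. ?D v x)) (at x)" if "x \<in> S" for x
  proof -
    have f: "(f has_derivative frechet_derivative f (at (g x))) (at (g x))"
      and g: "(g has_derivative frechet_derivative g (at x)) (at x)"
      using Suc.prems that assms(2) by (auto simp: frechet_derivative_works[symmetric])
    have lin: "linear (frechet_derivative f (at (g x)))"
      using f by (rule has_derivative_linear)
    have "frechet_derivative f (at (g x)) (frechet_derivative g (at x) v) = ?D v x" for v
      by (subst euclidean_representation[of "frechet_derivative g (at x) v", symmetric])
         (simp only: linear_sum[OF lin] linear_cmul[OF lin])
    then show ?thesis
      using has_derivative_compose[OF g f] by simp
  qed
  have "higher_differentiable_on k S g"
    using higher_differentiable_on_SucD[OF Suc.prems(2)] .
  then have "higher_differentiable_on k S (?D v)" for v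
    by (intro higher_differentiable_on_sum higher_differentiable_on_scaleR assms(1) Suc.IH
        higher_differentiable_on_linear[OF bounded_linear_inner_left])
       (use Suc.prems in auto)
  then have "higher_differentiable_on k S (\<lambda>x. frechet_derivative (\<lambda>x. f (g x)) (at x) v)" for v
    by (rule higher_differentiable_on_cong[OF assms(1), rotated])
       (simp add: frechet_derivativeI[OF d])
  then show ?case using d by (auto simp: differentiable_def)
qed

lemma smooth_on_cong:
  "open S \<Longrightarrow> (\<And>x. x \<in> S \<Longrightarrow> f x = g x) \<Longrightarrow> smooth_on S f \<Longrightarrow> smooth_on S g"
  unfolding smooth_on_def
  by (rule allI, rule higher_differentiable_on_cong[of S f]) simp_all

lemma smooth_on_diff:
  assumes "open S" "smooth_on S f" "smooth_on S g"
  shows "smooth_on S (\<lambda>x. f x - g x)"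
  unfolding smooth_on_def
proof
  fix k
  have "higher_differentiable_on k S (\<lambda>x. - g x)"
    by (rule higher_differentiable_on_linear[OF bounded_linear_minus[OF bounded_linear_ident] assms(1)])
       (use assms(3) in \<open>simp add: smooth_on_def\<close>)
  then show "higher_differentiable_on k S (\<lambda>x. f x - g x)"
    using higher_differentiable_on_add[OF assms(1), of k f "\<lambda>x. - g x"] assms
    unfolding smooth_on_def by simp
qed

lemma smooth_on_differentiable: "smooth_on S f \<Longrightarrow> x \<in> S \<Longrightarrow> f differentiable at x"
  unfolding smooth_on_def using higher_differentiable_on.simps(2)[of _ S f] by blast

lemma smooth_on_directional_derivative:
  "smooth_on S f \<Longrightarrow> smooth_on S (\<lambda>x. frechet_derivative f (at x) v)"
  unfolding smooth_on_def using higher_differentiable_on.simps(2)[of _ S f] by blast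

lemma smooth_on_compose:
  assumes "open S" "g ` S \<subseteq> T" "smooth_on T f" "smooth_on S g"
  shows "smooth_on S (\<lambda>x. f (g x))"
  unfolding smooth_on_def
  by (rule allI, rule higher_differentiable_on_compose[OF assms(1,2)])
     (use assms(3,4) in \<open>simp_all add: smooth_on_def\<close>)

section \<open>The Koszul formula\<close>

text \<open>The linear map \<open>T\<close> with \<open>T u \<bullet> w = B u w\<close> is injective
  by nondegeneracy, hence surjective in finite dimension. This form of Riesz representation covers
  split-signature metrics.\<close>

lemma nondegenerate_bilinear_representation:
  fixes B :: "'n::euclidean_space \<Rightarrow> 'n \<Rightarrow> real"
  assumes B: "bilinear B" and nondeg: "\<And>v. (\<And>w. B v w = 0) \<Longrightarrow> v = 0" and "linear \<phi>"
  shows "\<exists>z. \<forall>w. B z w = \<phi> w"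
proof -
  define T where "T u = (\<Sum>b\<in>Basis. B u b *\<^sub>R b)" for u
  have T_inner: "T u \<bullet> w = B u w" for u w
  proof -
    have "B u w = B u (\<Sum>b\<in>Basis. (w \<bullet> b) *\<^sub>R b)" by (simp add: euclidean_representation)
    also have "\<dots> = (\<Sum>b\<in>Basis. (w \<bullet> b) * B u b)"
      using B by (simp add: bilinear_def linear_sum linear_cmul)
    finally show ?thesis
      unfolding T_def by (simp add: inner_sum_left inner_commute[of w] mult.commute)
  qed
  have "linear T"
    by (rule linearI; rule vector_eq_rdot[THEN iffD1])
       (simp_all add: T_inner inner_add_left bilinear_ladd[OF B] bilinear_lmul[OF B])
  moreover have "inj T"
    unfolding linear_injective_0[OF \<open>linear T\<close>] using nondeg by (metis T_inner inner_zero_left)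
  ultimately have "surj T" using linear_injective_imp_surjective by blast
  then obtain z where z: "T z = (\<Sum>b\<in>Basis. \<phi> b *\<^sub>R b)" by (metis surjD)
  have "B z w = \<phi> w" for w
  proof -
    have "\<phi> w = \<phi> (\<Sum>b\<in>Basis. (w \<bullet> b) *\<^sub>R b)" by (simp add: euclidean_representation)
    also have "\<dots> = (\<Sum>b\<in>Basis. \<phi> b *\<^sub>R b) \<bullet> w"
      using \<open>linear \<phi>\<close> by (simp add: linear_sum linear_cmul inner_sum_left inner_commute[of w] mult.commute)
    finally show ?thesis using z T_inner by metis
  qed
  then show ?thesis by blast
qed

text \<open>The description in \<open>levi_civita\<close> has exactly one solution, the one given by
  the Koszul formula; bracket terms are absent because the fields are constant. \<open>D\<close>
  stands for the first derivative of the metric at \<open>p\<close>.\<close>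

lemma levi_civita_koszul:
  fixes h :: "'n::euclidean_space \<Rightarrow> 'n \<Rightarrow> 'n \<Rightarrow> real"
  assumes B: "bilinear (h p)" and sym: "\<And>u v. h p u v = h p v u"
    and nondeg: "\<And>v. (\<And>w. h p v w = 0) \<Longrightarrow> v = 0"
    and D: "\<And>u v w. frechet_derivative (\<lambda>q. h q v w) (at p) u = D u v w"
    and lin1: "\<And>v w. linear (\<lambda>u. D u v w)" and lin2: "\<And>u w. linear (\<lambda>v. D u v w)"
    and Dsym: "\<And>u v w. D u v w = D u w v"
  shows "2 * h p (levi_civita h p u v) w = D u v w + D v u w - D w u v"
proof -
  have lin3: "linear (\<lambda>w. D u v w)" for u v by (subst Dsym) (rule lin2)
  let ?K = "\<lambda>u v w. (D u v w + D v u w - D w u v) / 2"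
  have "\<exists>z. \<forall>w. h p z w = ?K u v w" for u v
  proof (rule nondegenerate_bilinear_representation[OF B nondeg])
    show "linear (?K u v)"
      by (rule linearI) (simp_all add: linear_add[OF lin1] linear_add[OF lin3] linear_cmul[OF lin1]
          linear_cmul[OF lin3] field_simps)
  qed
  then obtain G where G: "h p (G u v) w = ?K u v w" for u v w by metis
  have eqI: "y = z" if "\<And>w. h p y w = h p z w" for y z
    using nondeg[of "y - z"] that by (simp add: bilinear_lsub[OF B])
  have bilG: "bilinear G"
    unfolding bilinear_def
    by (intro conjI allI linearI; rule eqI)
       (simp_all add: G bilinear_ladd[OF B] bilinear_lmul[OF B] linear_add[OF lin1]
          linear_add[OF lin2] linear_add[OF lin3] linear_cmul[OF lin1] linear_cmul[OF lin2]
          linear_cmul[OF lin3] field_simps)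
  have symG: "G u v = G v u" for u v
    by (rule eqI) (simp add: G Dsym[of _ u v] add.commute)
  have "levi_civita h p = G"
    unfolding levi_civita_def D
  proof (rule the_equality)
    show "bilinear G \<and> (\<forall>u v. G u v = G v u) \<and>
        (\<forall>u v w. D u v w = h p (G u v) w + h p v (G u w))"
    proof (intro conjI allI bilG symG)
      fix u v w
      \<comment> \<open>The sum \<open>?K u v w + ?K u w v\<close> collapses to
        \<open>D u v w\<close> by the symmetry of \<open>D\<close> in its last two
        arguments.\<close>
      show "D u v w = h p (G u v) w + h p v (G u w)"
        unfolding sym[of v] G
        by (simp add: Dsym[of v u w] Dsym[of w u v] Dsym[of u w v] field_simps)
    qed
  next
    fix G' assume G': "bilinear G' \<and> (\<forall>u v. G' u v = G' v u) \<and>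
        (\<forall>u v w. D u v w = h p (G' u v) w + h p v (G' u w))"
    show "G' = G"
    proof (intro ext eqI)
      fix u v w
      \<comment> \<open>Metric compatibility in three arrangements: the first plus the second minus
        the third is \<open>2 * h p (G' u v) w\<close>.\<close>
      have "D u v w = h p (G' u v) w + h p (G' u w) v"
        "D v u w = h p (G' u v) w + h p (G' v w) u"
        "D w u v = h p (G' u w) v + h p (G' v w) u"
        using G' sym by metis+
      then show "h p (G' u v) w = h p (G u v) w" unfolding G by simp
    qed
  qed
  then show ?thesis by (simp add: G)
qed

section \<open>Vector fields and connections in charts\<close>

lemma chart_inv_left: "is_chart c \<Longrightarrow> p \<in> fst c \<Longrightarrow> chart_inv c (snd c p) = p"
  by (auto simp: is_chart_def homeomorphism_def)

lemma chart_inv_right: "is_chart c \<Longrightarrow> x \<in> chart_image c \<Longrightarrow> snd c (chart_inv c x) = x"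
  by (auto simp: is_chart_def homeomorphism_def)

lemma chart_inv_mem: "is_chart c \<Longrightarrow> x \<in> chart_image c \<Longrightarrow> chart_inv c x \<in> fst c"
  by (auto simp: chart_inv_left)

text \<open>An image under the chart becomes a preimage under its continuous inverse, from which
  openness can be read off.\<close>

lemma chart_preimage:
  assumes "is_chart c"
  shows "snd c ` (fst c \<inter> W) = chart_image c \<inter> chart_inv c -` W"
  by (force simp: chart_inv_left[OF assms])

lemma open_chart_image_Int:
  assumes "is_chart c" "open W"
  shows "open (snd c ` (fst c \<inter> W))"
  unfolding chart_preimage[OF assms(1)]
  by (rule continuous_open_preimage)
     (use assms in \<open>auto simp: is_chart_def homeomorphism_def\<close>)

section \<open>Transition Jacobians and smooth vector fields\<close>

locale oriented_atlas =
  fixes A :: "'a::{t2_space,second_countable_topology} chart set"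
  assumes surface: "oriented_surface A"
begin

lemma chart: "c \<in> A \<Longrightarrow> is_chart c"
  using surface by (auto simp: oriented_surface_def)

lemma open_domain: "c \<in> A \<Longrightarrow> open (fst c)"
  using chart by (auto simp: is_chart_def)

lemma open_overlap: "c \<in> A \<Longrightarrow> d \<in> A \<Longrightarrow> open (snd c ` (fst c \<inter> fst d))"
  by (intro open_chart_image_Int chart open_domain)

lemma smooth_transition:
  "c \<in> A \<Longrightarrow> d \<in> A \<Longrightarrow> smooth_on (snd c ` (fst c \<inter> fst d)) (transition c d)"
  using surface by (auto simp: oriented_surface_def)

lemma transition_has_derivative:
  assumes "c \<in> A" "d \<in> A" "p \<in> fst c" "p \<in> fst d"
  shows "(transition c d has_derivative frechet_derivative (transition c d) (at (snd c p)))
    (at (snd c p))"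
  unfolding frechet_derivative_works[symmetric]
  by (rule smooth_on_differentiable[OF smooth_transition[OF assms(1,2)]]) (use assms in auto)

lemma transition_self_derivative:
  assumes "c \<in> A" "p \<in> fst c"
  shows "frechet_derivative (transition c c) (at (snd c p)) v = v"
proof -
  have "(transition c c has_derivative (\<lambda>v. v)) (at (snd c p))"
    by (rule has_derivative_transform_within_open[OF has_derivative_ident, of "chart_image c"])
       (use chart[OF assms(1)] assms(2) in \<open>auto simp: is_chart_def transition_def chart_inv_left chart\<close>)
  then show ?thesis by (simp add: frechet_derivativeI)
qed

text \<open>Near \<open>snd c p\<close> the map \<open>transition c e\<close> is
  \<open>transition d e\<close> after \<open>transition c d\<close>, so the chain rule gives this
  cocycle law of the Jacobians.\<close>

lemma transition_chain:
  assumes "c \<in> A" "d \<in> A" "e \<in> A" "p \<in> fst c" "p \<in> fst d" "p \<in> fst e"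
  shows "frechet_derivative (transition c e) (at (snd c p)) v
    = frechet_derivative (transition d e) (at (snd d p))
        (frechet_derivative (transition c d) (at (snd c p)) v)"
proof -
  have p: "transition c d (snd c p) = snd d p"
    using assms chart by (simp add: transition_def chart_inv_left)
  have "((\<lambda>x. transition d e (transition c d x)) has_derivative
      (\<lambda>v. frechet_derivative (transition d e) (at (snd d p))
        (frechet_derivative (transition c d) (at (snd c p)) v))) (at (snd c p))"
    using has_derivative_compose[of "transition c d" _ "snd c p" UNIV "transition d e"]
      transition_has_derivative[of c d p] transition_has_derivative[of d e p] assms p by simp
  then have "(transition c e has_derivative
      (\<lambda>v. frechet_derivative (transition d e) (at (snd d p))
        (frechet_derivative (transition c d) (at (snd c p)) v))) (at (snd c p))"
    by (rule has_derivative_transform_within_open[OF _ open_overlap[OF assms(1,2)]])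
       (use assms in \<open>auto simp: transition_def chart_inv_left chart\<close>)
  then show ?thesis by (simp add: frechet_derivativeI)
qed

lemma coord_field_self:
  "c \<in> A \<Longrightarrow> p \<in> fst c \<Longrightarrow> coord_field A c i p c = axis i 1"
  by (simp add: coord_field_def transition_self_derivative)

text \<open>Tangency is \<open>transition_chain\<close>. In a chart \<open>d\<close> the components
  are a column of the Jacobian of \<open>transition c d\<close> evaluated at
  \<open>transition d c x\<close>, hence smooth by composition.\<close>

lemma coord_field_vector_field:
  assumes c: "c \<in> A"
  shows "coord_field A c i \<in> vector_fields A (fst c)"
proof -
  have "coord_field A c i p \<in> tangent_space A p" if "p \<in> fst c" for p
    using that c unfolding tangent_space_def
    by (auto simp del: split_paired_All simp: coord_field_def intro: transition_chain)
  moreover have "smooth_on (snd d ` (fst d \<inter> fst c)) (field_comp d (coord_field A c i))"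
    if d: "d \<in> A" for d
  proof (rule smooth_on_cong[OF open_overlap[OF d c]])
    show "smooth_on (snd d ` (fst d \<inter> fst c))
        (\<lambda>x. frechet_derivative (transition c d) (at (transition d c x)) (axis i 1))"
    proof (rule smooth_on_compose[OF open_overlap[OF d c] _ _ smooth_transition[OF d c]])
      show "transition d c ` snd d ` (fst d \<inter> fst c) \<subseteq> snd c ` (fst c \<inter> fst d)"
        by (auto simp: transition_def chart_inv_left chart d)
      show "smooth_on (snd c ` (fst c \<inter> fst d))
          (\<lambda>x. frechet_derivative (transition c d) (at x) (axis i 1))"
        by (rule smooth_on_directional_derivative[OF smooth_transition[OF c d]])
    qed
  qed (auto simp: field_comp_def coord_field_def transition_def chart_inv_left chart d)
  ultimately show ?thesis by (simp add: vector_fields_def)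
qed

text \<open>\<open>Z\<close> is prescribed only over \<open>W\<close>, because
  \<open>bracket\<close>, to which this is applied, is identified with a difference of fields only
  there.\<close>

lemma vector_fields_diff:
  assumes "open W" "X \<in> vector_fields A W" "Y \<in> vector_fields A W"
    and Z: "\<And>p c. p \<in> W \<Longrightarrow> Z p c = X p c - Y p c"
  shows "Z \<in> vector_fields A W"
proof -
  have "Z p \<in> tangent_space A p" if p: "p \<in> W" for p
  proof -
    have t: "X p \<in> tangent_space A p" "Y p \<in> tangent_space A p"
      using assms(2,3) p by (auto simp: vector_fields_def)
    have "Z p d = frechet_derivative (transition c d) (at (snd c p)) (Z p c)"
      if "c \<in> A" "d \<in> A" "p \<in> fst c" "p \<in> fst d" for c d
    proof -
      have "linear (frechet_derivative (transition c d) (at (snd c p)))"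
        using transition_has_derivative[OF that] by (rule has_derivative_linear)
      moreover have "X p d = frechet_derivative (transition c d) (at (snd c p)) (X p c)"
        "Y p d = frechet_derivative (transition c d) (at (snd c p)) (Y p c)"
        using t that unfolding tangent_space_def by blast+
      ultimately show ?thesis using Z[OF p] by (simp add: linear_diff)
    qed
    moreover have "Z p c = 0" if "c \<notin> A \<or> p \<notin> fst c" for c
    proof -
      have "X p c = 0" "Y p c = 0" using t that unfolding tangent_space_def by blast+
      then show ?thesis by (simp add: Z[OF p])
    qed
    ultimately show ?thesis unfolding tangent_space_def by blast
  qed
  moreover have "smooth_on (snd c ` (fst c \<inter> W)) (field_comp c Z)" if c: "c \<in> A" for c
  proof (rule smooth_on_cong)
    show op: "open (snd c ` (fst c \<inter> W))" by (intro open_chart_image_Int chart c assms)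
    show "smooth_on (snd c ` (fst c \<inter> W)) (\<lambda>x. field_comp c X x - field_comp c Y x)"
      by (rule smooth_on_diff[OF op]) (use assms c in \<open>auto simp: vector_fields_def\<close>)
  qed (auto simp: field_comp_def chart_inv_left chart c Z)
  ultimately show ?thesis by (simp add: vector_fields_def)
qed

end

section \<open>Torsion-free connections: smoothness of curvature, symmetry of Christoffel
  symbols\<close>

locale torsion_free_connection = oriented_atlas A
  for A :: "'a::{t2_space,second_countable_topology} chart set" +
  fixes nabla :: "'a field \<Rightarrow> 'a field \<Rightarrow> 'a field"
  assumes connection: "connection A nabla" and torsion_free: "torsion_free A nabla"
begin

lemma nabla_vector_field:
  "open W \<Longrightarrow> X \<in> vector_fields A W \<Longrightarrow> Y \<in> vector_fields A W \<Longrightarrow> nabla X Y \<in> vector_fields A W"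
  using connection unfolding connection_def by blast

lemma nabla_torsion_free:
  "open W \<Longrightarrow> X \<in> vector_fields A W \<Longrightarrow> Y \<in> vector_fields A W \<Longrightarrow> p \<in> W \<Longrightarrow>
    nabla X Y p c - nabla Y X p c = bracket A X Y p c"
  using torsion_free unfolding torsion_free_def by blast

text \<open>Torsion-freeness presents the bracket as a difference of two covariant derivatives, so
  its transformation law between charts need not be computed.\<close>

lemma bracket_vector_field:
  assumes "open W" "X \<in> vector_fields A W" "Y \<in> vector_fields A W"
  shows "bracket A X Y \<in> vector_fields A W"
  by (rule vector_fields_diff[OF assms(1), of "nabla X Y" "nabla Y X"])
     (simp_all add: nabla_vector_field nabla_torsion_free[OF assms] assms)

lemma curvature_vector_field:
  assumes "open W" "X \<in> vector_fields A W" "Y \<in> vector_fields A W" "Z \<in> vector_fields A W"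
  shows "curvature A nabla Z X Y \<in> vector_fields A W"
proof -
  have "(\<lambda>p c. nabla Z (nabla X Y) p c - nabla X (nabla Z Y) p c) \<in> vector_fields A W"
    by (rule vector_fields_diff[OF assms(1), of "nabla Z (nabla X Y)" "nabla X (nabla Z Y)"])
       (simp_all add: nabla_vector_field assms)
  then show ?thesis
    by (rule vector_fields_diff[OF assms(1) _
          nabla_vector_field[OF assms(1) bracket_vector_field[OF assms(1,4,2)] assms(3)]])
       (simp add: curvature_def)
qed

lemma field_comp_differentiable:
  assumes "c \<in> A" "x \<in> chart_image c" "X \<in> vector_fields A (fst c)"
  shows "field_comp c X differentiable at x"
proof (rule smooth_on_differentiable)
  show "smooth_on (chart_image c) (field_comp c X)"
    using assms by (auto simp: vector_fields_def dest!: bspec[of _ _ c])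
qed fact

text \<open>A Christoffel symbol is a chart component of a smooth field. Its differentiability
  enters through the product with the fibre coordinate in the cotangent metric.\<close>

lemma christoffel_differentiable:
  assumes "c \<in> A" "x \<in> chart_image c"
  shows "christoffel A nabla c k i j differentiable at x"
proof -
  have "field_comp c (nabla (coord_field A c i) (coord_field A c j)) differentiable at x"
    by (intro field_comp_differentiable nabla_vector_field coord_field_vector_field open_domain assms)
  then show ?thesis
    unfolding christoffel_def field_comp_def differentiable_def
    by (auto dest: bounded_linear.has_derivative[OF bounded_linear_vec_nth, of _ _ _ k])
qed

text \<open>Each summand of the Ricci trace is a chart component of a smooth curvature
  field.\<close>

lemma ric_differentiable:
  assumes "c \<in> A" "x \<in> chart_image c"
  shows "(\<lambda>y. ric A nabla c y $ i $ j) differentiable at x"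
proof -
  have "(\<lambda>y. field_comp c (curvature A nabla (coord_field A c k) (coord_field A c i)
      (coord_field A c j)) y $ k) differentiable at x" for k
  proof -
    have "field_comp c (curvature A nabla (coord_field A c k) (coord_field A c i)
        (coord_field A c j)) differentiable at x"
      by (intro field_comp_differentiable curvature_vector_field coord_field_vector_field
          open_domain assms)
    then show ?thesis
      unfolding differentiable_def
      by (auto dest: bounded_linear.has_derivative[OF bounded_linear_vec_nth, of _ _ _ k])
  qed
  then show ?thesis
    unfolding ric_def ricci_def field_comp_def by (simp add: differentiable_sum)
qed

text \<open>Coordinate fields have constant components in their own chart, so their bracket vanishes
  there.\<close>

lemma christoffel_sym:
  assumes c: "c \<in> A" and x: "x \<in> chart_image c"
  shows "christoffel A nabla c k i j x = christoffel A nabla c k j i x"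
proof -
  have p: "chart_inv c x \<in> fst c" using chart_inv_mem[OF chart[OF c] x] .
  have "frechet_derivative (field_comp c (coord_field A c i)) (at x) v = 0" for i v
  proof -
    have "(field_comp c (coord_field A c i) has_derivative (\<lambda>v. 0)) (at x)"
      by (rule has_derivative_transform_within_open[OF has_derivative_const, of "chart_image c"])
         (use chart[OF c] x in \<open>auto simp: is_chart_def field_comp_def coord_field_self[OF c]
            chart_inv_left chart\<close>)
    then show ?thesis by (simp add: frechet_derivativeI)
  qed
  then have "bracket A (coord_field A c i) (coord_field A c j) (chart_inv c x) c = 0"
    by (simp add: bracket_def chart_inv_right[OF chart[OF c] x])
  then have "nabla (coord_field A c i) (coord_field A c j) (chart_inv c x) c
      = nabla (coord_field A c j) (coord_field A c i) (chart_inv c x) c"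
    using nabla_torsion_free[OF open_domain[OF c] coord_field_vector_field[OF c]
        coord_field_vector_field[OF c] p, of i j c] by simp
  then show ?thesis by (simp add: christoffel_def)
qed

end

section \<open>Matrix inverses\<close>

lemma matrix_inv_mult:
  fixes M :: "'a::field^'n^'n"
  assumes "invertible M"
  shows "M ** matrix_inv M = mat 1" "matrix_inv M ** M = mat 1"
  using someI_ex[OF assms[unfolded invertible_def]] unfolding matrix_inv_def by simp_all

text \<open>For square matrices over a field a right inverse is also a left inverse.\<close>

lemma matrix_inv_eqI:
  fixes M N :: "'a::field^'n^'n"
  assumes "M ** N = mat 1"
  shows "matrix_inv M = N"
proof -
  have "invertible M"
    using assms matrix_left_right_inverse unfolding invertible_def by blast
  then have "matrix_inv M ** (M ** N) = N"
    by (simp add: matrix_mul_assoc matrix_inv_mult)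
  then show ?thesis using assms by simp
qed

lemma matrix_inv_uminus:
  fixes M :: "'a::field^'n^'n"
  assumes "invertible M"
  shows "matrix_inv (- M) = - matrix_inv M"
proof (rule matrix_inv_eqI)
  have "- M ** - matrix_inv M = M ** matrix_inv M"
    by (simp add: matrix_matrix_mult_def vec_eq_iff)
  then show "- M ** - matrix_inv M = mat 1" using matrix_inv_mult[OF assms] by simp
qed

text \<open>Applied to the symmetric Ricci matrix, this makes its inverse symmetric.\<close>

lemma matrix_inv_transpose:
  fixes M :: "'a::field^'n^'n"
  assumes "invertible M"
  shows "matrix_inv (transpose M) = transpose (matrix_inv M)"
  by (rule matrix_inv_eqI)
     (use matrix_inv_mult[OF assms] in \<open>simp flip: matrix_transpose_mul\<close>)

section \<open>The zero section\<close>

context torsion_free_connection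
begin

lemma lagrangian_ric:
  assumes "lagrangian A nabla" "c \<in> A" "x \<in> chart_image c"
  shows "transpose (ric A nabla c x) = ric A nabla c x"
    and "ric_sym A nabla c x = ric A nabla c x"
    and "schout A nabla c x = ric A nabla c x"
proof -
  have 0: "ric_anti A nabla c x = 0" using assms unfolding lagrangian_def by blast
  then show 1: "transpose (ric A nabla c x) = ric A nabla c x"
    by (simp add: ric_anti_def)
  then show 2: "ric_sym A nabla c x = ric A nabla c x"
    by (simp add: ric_sym_def flip: scaleR_left_distrib scaleR_2)
  then show "schout A nabla c x = ric A nabla c x"
    by (simp add: schout_def 0)
qed

lemma ric_nth_sym:
  assumes "lagrangian A nabla" "c \<in> A" "x \<in> chart_image c"
  shows "ric A nabla c x $ i $ j = ric A nabla c x $ j $ i"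
  using arg_cong[OF lagrangian_ric(1)[OF assms], of "\<lambda>M. M $ j $ i"] by (simp add: transpose_def)

definition ric_deriv :: "'a chart \<Rightarrow> real^2 \<Rightarrow> real^2 \<Rightarrow> 2 \<Rightarrow> 2 \<Rightarrow> real" where
  "ric_deriv c x u i j = frechet_derivative (\<lambda>y. ric A nabla c y $ i $ j) (at x) u"

lemma ric_deriv_linear:
  assumes "c \<in> A" "x \<in> chart_image c"
  shows "linear (\<lambda>u. ric_deriv c x u i j)"
  unfolding ric_deriv_def
  using linear_frechet_derivative[OF ric_differentiable[OF assms, of i j]] .

text \<open>\<open>schout\<close> and \<open>ric\<close> are known to agree only on the chart image;
  as this set is open, the derivative carries over.\<close>

lemma schout_has_derivative:
  assumes "lagrangian A nabla" "c \<in> A" "x \<in> chart_image c"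
  shows "((\<lambda>y. schout A nabla c y $ i $ j) has_derivative (\<lambda>u. ric_deriv c x u i j)) (at x)"
proof (rule has_derivative_transform_within_open[of "\<lambda>y. ric A nabla c y $ i $ j"])
  show "((\<lambda>y. ric A nabla c y $ i $ j) has_derivative (\<lambda>u. ric_deriv c x u i j)) (at x)"
    unfolding ric_deriv_def using ric_differentiable[OF assms(2,3)] frechet_derivative_works by blast
  show "open (chart_image c)" using chart[OF assms(2)] by (simp add: is_chart_def)
qed (use assms in \<open>auto simp: lagrangian_ric\<close>)

lemma ric_deriv_sym:
  assumes "lagrangian A nabla" "c \<in> A" "x \<in> chart_image c"
  shows "ric_deriv c x u i j = ric_deriv c x u j i"
proof -
  have "((\<lambda>y. ric A nabla c y $ i $ j) has_derivative (\<lambda>u. ric_deriv c x u j i)) (at x)"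
  proof (rule has_derivative_transform_within_open[OF schout_has_derivative[OF assms]])
    show "open (chart_image c)" using chart[OF assms(2)] by (simp add: is_chart_def)
    show "schout A nabla c y $ j $ i = ric A nabla c y $ i $ j" if "y \<in> chart_image c" for y
      by (simp add: lagrangian_ric[OF assms(1,2) that] ric_nth_sym[OF assms(1,2) that, of j])
  qed fact
  then show ?thesis by (simp add: ric_deriv_def frechet_derivativeI)
qed

section \<open>The cotangent metric and its first derivative along the zero section\<close>

lemma cotangent_metric_eq:
  "cotangent_metric A nabla c q v w =
     (1/2) * (\<Sum>i\<in>UNIV. snd v $ i * fst w $ i + snd w $ i * fst v $ i)
     - (1/2) * (\<Sum>i\<in>UNIV. \<Sum>j\<in>UNIV.
         ((\<Sum>k\<in>UNIV. snd q $ k * christoffel A nabla c k i j (fst q)) + snd q $ i * snd q $ j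
           + schout A nabla c (fst q) $ j $ i) * (fst v $ j * fst w $ i + fst w $ j * fst v $ i))"
  by (simp add: cotangent_metric_def psi_def split_beta sum_2 field_simps)

text \<open>The derivative of the metric at \<open>(x, 0)\<close> in direction \<open>u\<close>.
  Derivatives of Christoffel symbols and the quadratic fibre term are absent, since they come with a
  factor that vanishes at the zero covector.\<close>

definition metric_deriv ::
    "'a chart \<Rightarrow> real^2 \<Rightarrow> (real^2) \<times> (real^2) \<Rightarrow> (real^2) \<times> (real^2) \<Rightarrow> (real^2) \<times> (real^2) \<Rightarrow> real" where
  "metric_deriv c x u v w = - (1/2) * (\<Sum>i\<in>UNIV. \<Sum>j\<in>UNIV.
     ((\<Sum>k\<in>UNIV. snd u $ k * christoffel A nabla c k i j x) + ric_deriv c x (fst u) j i)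
       * (fst v $ j * fst w $ i + fst w $ j * fst v $ i))"

lemma cotangent_metric_has_derivative:
  assumes "lagrangian A nabla" "c \<in> A" "x \<in> chart_image c"
  shows "((\<lambda>q. cotangent_metric A nabla c q v w) has_derivative (\<lambda>u. metric_deriv c x u v w))
    (at (x, 0))"
proof -
  have nth: "((\<lambda>q. snd q $ i) has_derivative (\<lambda>u. snd u $ i)) (at (x, 0 :: real^2))" for i :: 2
    by (intro bounded_linear.has_derivative[OF bounded_linear_vec_nth] has_derivative_snd
        has_derivative_ident)
  have base: "((\<lambda>q. f (fst q)) has_derivative (\<lambda>u. f' (fst u))) (at (x, 0 :: real^2))"
    if "(f has_derivative f') (at x)" for f :: "real^2 \<Rightarrow> real" and f'
    using has_derivative_compose[OF has_derivative_fst[OF has_derivative_ident], of f f' "(x, 0)"] that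
    by simp
  have "((\<lambda>q. christoffel A nabla c k i j (fst q)) has_derivative
      (\<lambda>u. frechet_derivative (christoffel A nabla c k i j) (at x) (fst u))) (at (x, 0 :: real^2))" for k i j
    by (rule base) (use christoffel_differentiable[OF assms(2,3)] frechet_derivative_works in blast)
  \<comment> \<open>The other term of the product rule is the derivative of the Christoffel symbol
    times \<open>snd (x, 0) $ k\<close>, which is zero.\<close>
  from has_derivative_mult[OF nth this]
  have G: "((\<lambda>q. snd q $ k * christoffel A nabla c k i j (fst q)) has_derivative
      (\<lambda>u. snd u $ k * christoffel A nabla c k i j x)) (at (x, 0 :: real^2))" for k i j
    by simp
  have Q: "((\<lambda>q. snd q $ i * snd q $ j) has_derivative (\<lambda>u. 0)) (at (x, 0 :: real^2))" for i j :: 2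
    using has_derivative_mult[OF nth[of i] nth[of j]] by simp
  show ?thesis
    unfolding cotangent_metric_eq metric_deriv_def
    by (rule derivative_eq_intros G Q base[OF schout_has_derivative[OF assms]] refl)+ simp
qed

section \<open>The zero section in coordinates\<close>

lemma zero_section_coordinates:
  assumes "c \<in> A" "x \<in> chart_image c"
  shows "(cotangent_chart A c \<circ> zero_section \<circ> chart_inv c) x = (x, 0)"
  using assms by (auto simp: cotangent_chart_def zero_section_def chart_inv_right chart vec_eq_iff)

lemma zero_section_derivative:
  assumes "c \<in> A" "x \<in> chart_image c"
  shows "frechet_derivative (cotangent_chart A c \<circ> zero_section \<circ> chart_inv c) (at x) v = (v, 0)"
proof -
  have "((cotangent_chart A c \<circ> zero_section \<circ> chart_inv c) has_derivative (\<lambda>v. (v, 0))) (at x)"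
  proof (rule has_derivative_transform_within_open[of "\<lambda>x. (x, 0)"])
    show "((\<lambda>x. (x, 0)) has_derivative (\<lambda>v. (v, 0))) (at x)"
      by (intro has_derivative_Pair has_derivative_ident has_derivative_const)
    show "open (chart_image c)" using chart[OF assms(1)] by (simp add: is_chart_def)
  qed (use assms zero_section_coordinates in auto)
  then show ?thesis by (simp add: frechet_derivativeI)
qed

text \<open>The first derivative is the constant \<open>(v, 0)\<close> on the open chart image, so
  only the Levi-Civita term survives in the second fundamental form.\<close>

lemma zero_section_second_derivative:
  assumes "c \<in> A" "x \<in> chart_image c"
  shows "frechet_derivative (\<lambda>y. frechet_derivative
    (cotangent_chart A c \<circ> zero_section \<circ> chart_inv c) (at y) v) (at x) u = 0"
proof -
  have "((\<lambda>y. frechet_derivative (cotangent_chart A c \<circ> zero_section \<circ> chart_inv c) (at y) v)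
      has_derivative (\<lambda>v. 0)) (at x)"
  proof (rule has_derivative_transform_within_open[of "\<lambda>x. (v, 0)"])
    show "open (chart_image c)" using chart[OF assms(1)] by (simp add: is_chart_def)
  qed (use assms zero_section_derivative in auto)
  then show ?thesis by (simp add: frechet_derivativeI)
qed

section \<open>Levi-Civita connection and normal projection along the zero section\<close>

lemma cotangent_metric_zero:
  assumes "lagrangian A nabla" "c \<in> A" "x \<in> chart_image c"
  shows "cotangent_metric A nabla c (x, 0) v w =
    (snd v \<bullet> fst w + snd w \<bullet> fst v) / 2 - fst w \<bullet> (ric A nabla c x *v fst v)"
proof -
  have s: "ric A nabla c x $ j $ i = ric A nabla c x $ i $ j" for i j
    by (rule ric_nth_sym[OF assms])
  show ?thesis
    by (simp add: cotangent_metric_eq lagrangian_ric[OF assms] sum_2 inner_vec_def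
        matrix_vector_mult_def s[of 2 1] field_simps)
qed

lemma levi_civita_zero_section:
  assumes "lagrangian A nabla" "c \<in> A" "x \<in> chart_image c"
  shows "2 * cotangent_metric A nabla c (x, 0)
      (levi_civita (cotangent_metric A nabla c) (x, 0) u v) w
    = metric_deriv c x u v w + metric_deriv c x v u w - metric_deriv c x w u v"
proof (rule levi_civita_koszul[where D = "metric_deriv c x"])
  let ?h = "cotangent_metric A nabla c (x, 0)"
  show "bilinear ?h"
    unfolding bilinear_def cotangent_metric_zero[OF assms]
    by (auto intro!: linearI simp: inner_add_left inner_add_right matrix_vector_right_distrib
        matrix_vector_mult_scaleR field_simps)
  show "?h u v = ?h v u" for u v
    by (simp add: cotangent_metric_def add.commute)
  show "v = 0" if v: "\<And>w. ?h v w = 0" for v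
  proof -
    \<comment> \<open>Pairing with the vertical vector \<open>(0, fst v)\<close> gives half the
      squared norm of \<open>fst v\<close>; once this is zero, \<open>(snd v, 0)\<close> does the
      same for \<open>snd v\<close>.\<close>
    have "fst v = 0"
      using v[of "(0, fst v)"] by (simp add: cotangent_metric_zero[OF assms])
    moreover from this have "snd v = 0"
      using v[of "(snd v, 0)"] by (simp add: cotangent_metric_zero[OF assms])
    ultimately show "v = 0" by (simp add: prod_eq_iff)
  qed
  show "frechet_derivative (\<lambda>q. cotangent_metric A nabla c q v w) (at (x, 0)) u = metric_deriv c x u v w"
    for u v w
    by (rule fun_cong[OF frechet_derivativeI[OF cotangent_metric_has_derivative[OF assms]]])
  show "linear (\<lambda>u. metric_deriv c x u v w)" for v w
    using cotangent_metric_has_derivative[OF assms] by (rule has_derivative_linear)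
  show "linear (\<lambda>v. metric_deriv c x u v w)" for u w
    by (rule linearI) (simp_all add: metric_deriv_def sum_2 algebra_simps)
  show "metric_deriv c x u v w = metric_deriv c x u w v" for u v w
    by (simp add: metric_deriv_def add.commute)
qed

lemma levi_civita_zero_section_snd:
  assumes "lagrangian A nabla" "c \<in> A" "x \<in> chart_image c"
  shows "snd (levi_civita (cotangent_metric A nabla c) (x, 0) (axis i 1, 0) (axis j 1, 0)) $ k
    = cov_deriv_ric A nabla c k i j x - cov_deriv_ric A nabla c i j k x - cov_deriv_ric A nabla c j i k x"
proof -
  let ?G = "levi_civita (cotangent_metric A nabla c) (x, 0) (axis i 1, 0) (axis j 1, 0)"
  let ?R = "ric A nabla c x" and ?C = "\<lambda>m i j. christoffel A nabla c m i j x"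
  have s: "?R $ j $ i = ?R $ i $ j" for i j
    by (rule ric_nth_sym[OF assms])
  note C = christoffel_sym[OF assms(2,3)]
  \<comment> \<open>Only the index pairs \<open>(i, j)\<close> and \<open>(j, i)\<close> contribute;
    for \<open>i = j\<close> the same entry is counted twice.\<close>
  have sum_axis: "(\<Sum>a\<in>UNIV. \<Sum>b\<in>UNIV. f a b * (axis i 1 $ b * axis j 1 $ a + axis j 1 $ b * axis i 1 $ a))
      = f j i + f i j" for f :: "2 \<Rightarrow> 2 \<Rightarrow> real" and i j :: 2
    using exhaust_2[of i] exhaust_2[of j] by (auto simp: sum_2 axis_def)
  have lin0: "ric_deriv c x 0 a b = 0" for a b
    by (rule linear_0[OF ric_deriv_linear[OF assms(2,3)]])
  have D: "metric_deriv c x (axis k 1, 0) (axis i 1, 0) (axis j 1, 0) = - ric_deriv c x (axis k 1) i j"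
    for i j k
    unfolding metric_deriv_def using sum_axis[of "\<lambda>a b. ric_deriv c x (axis k 1) b a" i j]
    by (simp add: ric_deriv_sym[OF assms, of _ j i])
  \<comment> \<open>A vertical direction has zero base part, so the Ricci derivative drops out by
    \<open>lin0\<close>; the Christoffel symbol appears twice by symmetry, which absorbs the factor
    1/2.\<close>
  have D': "metric_deriv c x (0, axis k 1) (axis i 1, 0) (axis j 1, 0) = - ?C k i j" for k
    unfolding metric_deriv_def using sum_axis[of "\<lambda>a b. (\<Sum>m\<in>UNIV. axis k 1 $ m * ?C m a b)" i j]
    using exhaust_2[of k] by (auto simp: lin0 C[of _ j i] sum_2 axis_def)
  have D0: "metric_deriv c x u v (0, w) = 0" for u v w
    by (simp add: metric_deriv_def)
  \<comment> \<open>Against \<open>(0, axis m 1)\<close> the left side of the Koszul formula is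
    \<open>fst ?G $ m\<close>, and by \<open>D0\<close> only the last term on the right
    survives.\<close>
  have fst: "fst ?G $ m = ?C m i j" for m
    using levi_civita_zero_section[OF assms, of "(axis i 1, 0)" "(axis j 1, 0)" "(0, axis m 1)"]
    by (simp add: D' D0 cotangent_metric_zero[OF assms] inner_axis inner_axis')
  \<comment> \<open>Against \<open>(axis k 1, 0)\<close> the left side is
    \<open>snd ?G $ k - 2 * (?R *v fst ?G) $ k\<close>.\<close>
  have "snd ?G $ k = 2 * (?R *v fst ?G) $ k - ric_deriv c x (axis i 1) j k
      - ric_deriv c x (axis j 1) i k + ric_deriv c x (axis k 1) i j"
    using levi_civita_zero_section[OF assms, of "(axis i 1, 0)" "(axis j 1, 0)" "(axis k 1, 0)"]
    by (simp add: D cotangent_metric_zero[OF assms] inner_axis inner_axis')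
  also have "(?R *v fst ?G) $ k = (\<Sum>m\<in>UNIV. ?C m i j * ?R $ m $ k)"
    by (simp add: matrix_vector_mult_def fst s[of k] mult.commute)
  \<comment> \<open>Among the three covariant derivatives, the Christoffel terms with lower index
    \<open>k\<close> cancel, and the two with lower indices \<open>i\<close>, \<open>j\<close> add
    up to the factor 2.\<close>
  finally show ?thesis
    unfolding cov_deriv_ric_def ric_deriv_def[symmetric]
    by (simp add: C[of _ k i] C[of _ k j] C[of _ j i] s[of i] s[of _ j] mult.commute
        ric_deriv_sym[OF assms, of _ k])
qed

text \<open>A tangential correction \<open>(w, 0)\<close> changes only the base part, so the fibre
  part of the normal component is that of \<open>V\<close>; orthogonality then fixes the base part
  because the Ricci matrix is invertible.\<close>

lemma normal_part_zero_section:
  assumes "lagrangian A nabla" "c \<in> A" "x \<in> chart_image c" and inv: "invertible (ric A nabla c x)"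
  shows "normal_part (cotangent_metric A nabla c)
      (cotangent_chart A c \<circ> zero_section \<circ> chart_inv c) x V
    = ((1/2) *\<^sub>R (matrix_inv (ric A nabla c x) *v snd V), snd V)"
proof -
  let ?R = "ric A nabla c x"
  have R: "?R *v (matrix_inv ?R *v v) = v" "matrix_inv ?R *v (?R *v v) = v" for v
    using matrix_inv_mult[OF inv] by (simp_all add: matrix_vector_mul_assoc)
  show ?thesis
    unfolding normal_part_def zero_section_derivative[OF assms(2,3)]
      zero_section_coordinates[OF assms(2,3)] cotangent_metric_zero[OF assms(1-3)]
  proof (rule the_equality, goal_cases)
    case 1
    show ?case
    proof (intro conjI exI allI)
      show "V = (fst V - (1/2) *\<^sub>R (matrix_inv ?R *v snd V), 0)
          + ((1/2) *\<^sub>R (matrix_inv ?R *v snd V), snd V)"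
        by (simp add: prod_eq_iff)
    qed (simp add: matrix_vector_mult_scaleR R inner_commute)
  next
    case (2 N)
    then obtain w where "V = (w, 0) + N" by blast
    then have V: "snd N = snd V" by auto
    have "((1/2) *\<^sub>R snd N - ?R *v fst N) \<bullet> w = 0" for w
      using 2 by (auto simp: inner_diff_left inner_diff_right inner_commute)
    then have "(1/2) *\<^sub>R snd N - ?R *v fst N = 0" using inner_eq_zero_iff by blast
    then have "?R *v fst N = (1/2) *\<^sub>R snd V" using V by simp
    then have "matrix_inv ?R *v (?R *v fst N) = (1/2) *\<^sub>R (matrix_inv ?R *v snd V)"
      by (simp add: matrix_vector_mult_scaleR)
    then show ?case using V R by (simp add: prod_eq_iff)
  qed
qed

text \<open>Definiteness of either sign forces a trivial kernel.\<close>

lemma ric_invertible: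
  assumes "lagrangian A nabla" "timelike A nabla \<or> spacelike A nabla"
    and "c \<in> A" "x \<in> chart_image c"
  shows "invertible (ric A nabla c x)"
proof -
  have "u = 0" if "ric A nabla c x *v u = 0" for u
    using assms that lagrangian_ric(2)[OF assms(1,3,4)]
    unfolding timelike_def spacelike_def by (metis inner_zero_right less_irrefl)
  then have "\<exists>B. B ** ric A nabla c x = mat 1"
    by (simp add: matrix_left_invertible_ker)
  then show ?thesis by (simp add: invertible_left_inverse)
qed

end

section \<open>The trace of the second fundamental form\<close>

theorem theorem4p3:
  fixes A :: "'a::{t2_space,second_countable_topology} chart set"
    and nabla :: "'a field \<Rightarrow> 'a field \<Rightarrow> 'a field"
  assumes "oriented_surface A"
    and "connection A nabla" and "torsion_free A nabla"
    and "lagrangian A nabla"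
    and "timelike A nabla \<or> spacelike A nabla"
  shows "minimal_connection A nabla \<longleftrightarrow>
    (\<forall>c\<in>A. \<forall>x\<in>chart_image c. \<forall>k.
       (\<Sum>i\<in>UNIV. \<Sum>j\<in>UNIV. matrix_inv (ric A nabla c x) $ i $ j *
          (2 * cov_deriv_ric A nabla c i j k x - cov_deriv_ric A nabla c k i j x)) = 0)"
proof -
  interpret torsion_free_connection A nabla
    using assms by unfold_locales
  have "(\<Sum>i\<in>UNIV. \<Sum>j\<in>UNIV. matrix_inv (induced_metric A nabla c x) $ i $ j *\<^sub>R
        second_fundamental_form (cotangent_metric A nabla c)
          (cotangent_chart A c \<circ> zero_section \<circ> chart_inv c) x (axis i 1) (axis j 1)) = 0 \<longleftrightarrow>
      (\<forall>k. (\<Sum>i\<in>UNIV. \<Sum>j\<in>UNIV. matrix_inv (ric A nabla c x) $ i $ j *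
          (2 * cov_deriv_ric A nabla c i j k x - cov_deriv_ric A nabla c k i j x)) = 0)"
    (is "?H = 0 \<longleftrightarrow> (\<forall>k. ?T k = 0)") if c: "c \<in> A" and x: "x \<in> chart_image c" for c x
  proof -
    let ?R = "ric A nabla c x"
    let ?g = "\<lambda>i j. matrix_inv (induced_metric A nabla c x) $ i $ j"
    \<comment> \<open>\<open>?N\<close> rebuilds a normal vector from its fibre part; its linearity
      moves the trace to the fibre parts \<open>V i j\<close>.\<close>
    let ?N = "\<lambda>v :: real^2. ((1/2) *\<^sub>R (matrix_inv ?R *v v), v)"
    define V where "V i j = snd (levi_civita (cotangent_metric A nabla c) (x, 0)
      (axis i 1, 0) (axis j 1, 0))" for i j
    have inv: "invertible ?R" by (rule ric_invertible[OF assms(4,5) c x])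
    have sff: "second_fundamental_form (cotangent_metric A nabla c)
          (cotangent_chart A c \<circ> zero_section \<circ> chart_inv c) x (axis i 1) (axis j 1) = ?N (V i j)" for i j
      unfolding second_fundamental_form_def normal_part_zero_section[OF assms(4) c x inv]
        zero_section_second_derivative[OF c x] zero_section_derivative[OF c x]
        zero_section_coordinates[OF c x] V_def by simp
    have linN: "linear ?N"
      by (rule linearI) (simp_all add: matrix_vector_right_distrib matrix_vector_mult_scaleR algebra_simps)
    define W where "W = (\<Sum>i\<in>UNIV. \<Sum>j\<in>UNIV. ?g i j *\<^sub>R V i j)"
    have "?H = ?N W"
      unfolding sff W_def by (simp only: linear_sum[OF linN] linear_cmul[OF linN])
    \<comment> \<open>\<open>?N\<close> has its argument as second component and is therefore
      injective.\<close>
    then have "?H = 0 \<longleftrightarrow> W = 0" by (auto simp: prod_eq_iff)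
    also have "\<dots> \<longleftrightarrow> (\<forall>k. W $ k = 0)" by (simp add: vec_eq_iff)
    also have "\<dots> \<longleftrightarrow> (\<forall>k. ?T k = 0)"
    proof (intro all_cong1)
      fix k
      \<comment> \<open>Symmetry of the inverse merges the two covariant derivatives that differ by
        exchanging \<open>i\<close> and \<open>j\<close> into the factor 2 of
        \<open>?T\<close>.\<close>
      have sym: "matrix_inv ?R $ i $ j = matrix_inv ?R $ j $ i" for i j
        using arg_cong[OF matrix_inv_transpose[OF inv, unfolded lagrangian_ric(1)[OF assms(4) c x]],
            of "\<lambda>M. M $ i $ j"]
        by (simp add: transpose_def)
      have "(\<Sum>i\<in>UNIV. \<Sum>j\<in>UNIV. matrix_inv ?R $ i $ j * V i j $ k) = - ?T k"
        unfolding V_def levi_civita_zero_section_snd[OF assms(4) c x]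
        by (simp add: sum_2 sym[of 2 1] algebra_simps)
      moreover have "W $ k = (\<Sum>i\<in>UNIV. \<Sum>j\<in>UNIV. ?g i j * V i j $ k)"
        by (simp add: W_def)
      \<comment> \<open>The induced metric is the Ricci matrix in the timelike case and its negative
        otherwise; this affects the sign of \<open>W $ k\<close> but not its vanishing.\<close>
      ultimately have "W $ k = - ?T k \<or> W $ k = ?T k"
        using matrix_inv_uminus[OF inv] by (simp add: induced_metric_def sum_negf split: if_splits)
      then show "W $ k = 0 \<longleftrightarrow> ?T k = 0" by auto
    qed
    finally show ?thesis .
  qed
  then show ?thesis unfolding minimal_connection_def by blast
qed

end
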